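(* Let $r\ge 3$ be an integer of the form $r=k(k+1)/2$ with $k$ an integer, and let $\alpha$ be a real number with $0<\alpha<\frac{1}{(r+1)\sqrt{2r}}$. There exist $N_0=N_0(\alpha,r)$ and a constant $\kappa=\kappa(\alpha,r)>0$, both depending only on $\alpha$ and $r$, such that for every integer $N>N_0$ and every set of integers $$C\subseteq [1,N^{1/r}],\qquad |C|>N^{(1-\alpha)/r},$$ there exist an integer $M<N$ and an increasing sequence of integers $$x_1,x_2,\ldots,x_n\in[1,2M],\qquad n>\kappa M^{\frac{1}{\sqrt2\, r^{5/2}(r+1)}-\frac{\alpha}{r^2}},$$ each of which is the product of exactly $r$ numbers from $C$, such that for all $1\le i\le n-1$, $$x_{i+1}-x_i=\kappa M^{1-\sqrt{2/r}+\varepsilon_i},\quad\text{where } \frac1r\le\varepsilon_i\le\frac3r.$$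
   Context: The $\varepsilon_i$ are real numbers (which may depend on all the data). *)

theory Defs
  imports Complex_Main
begin

end

theory Submission
  imports Defs "HOL-Computational_Algebra.Primes"
begin

text \<open>
  Let \<open>D = N powr (1 / r)\<close>, \<open>u = sqrt (2 * r)\<close> and let \<open>s\<close> be the integer part of \<open>u - 1 - \<alpha> * r\<close>.
  By the divisor bound, \<open>C\<close> has at least \<open>D powr (s * (1 - \<alpha>) - o(1))\<close> distinct \<open>s\<close>-fold products \<open>p\<close>.
  Multiplying them by \<open>b ^ (r - s)\<close> with \<open>b = Max C > D powr (1 - \<alpha>)\<close> gives \<open>r\<close>-fold products that
  differ pairwise by at least \<open>b ^ (r - s) \<ge> D powr (r - u + 1)\<close>, the smallest admissible gap. There are
  so many of them that, cutting \<open>[1, N]\<close> into intervals whose length is the largest admissible gap,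
  about \<open>D powr (r - u + 3)\<close>, some interval contains the required number of products; all gaps between
  consecutive ones are then admissible. This works with \<open>\<kappa> = 1\<close> and \<open>M = N - 1\<close>.
\<close>

section \<open>The divisor bound\<close>

lemma card_divisors_mult_le:
  fixes a b :: nat
  assumes "a > 0" "b > 0"
  shows "card {d. d dvd a * b} \<le> card {d. d dvd a} * card {d. d dvd b}"
proof -
  have "{d. d dvd a * b} \<subseteq> (\<lambda>(x, y). x * y) ` ({d. d dvd a} \<times> {d. d dvd b})"
  proof
    fix d assume "d \<in> {d. d dvd a * b}"
    then obtain x y where "d = x * y" "x dvd a" "y dvd b"
      using division_decomp[of d a b] by auto
    then show "d \<in> (\<lambda>(x, y). x * y) ` ({d. d dvd a} \<times> {d. d dvd b})"
      by (intro image_eqI[of _ _ "(x, y)"]) auto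
  qed
  then have "card {d. d dvd a * b} \<le> card ({d. d dvd a} \<times> {d. d dvd b})"
    using assms by (intro surj_card_le) (auto simp: finite_divisors_nat)
  then show ?thesis
    by (simp add: card_cartesian_product)
qed

lemma card_divisors_prod_le:
  fixes g :: "'a \<Rightarrow> nat"
  assumes "finite S" "\<And>p. p \<in> S \<Longrightarrow> g p > 0"
  shows "card {d. d dvd (\<Prod>p\<in>S. g p)} \<le> (\<Prod>p\<in>S. card {d. d dvd g p})"
  using assms
proof (induction S rule: finite_induct)
  case (insert p S)
  have "card {d. d dvd g p * (\<Prod>p\<in>S. g p)} \<le> card {d. d dvd g p} * card {d. d dvd (\<Prod>p\<in>S. g p)}"
    using insert by (intro card_divisors_mult_le prod_pos) auto
  also have "\<dots> \<le> card {d. d dvd g p} * (\<Prod>p\<in>S. card {d. d dvd g p})"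
    using insert by (intro mult_left_mono) auto
  finally show ?case using insert by simp
qed simp

lemma card_divisors_prime_power:
  fixes p :: nat
  assumes "prime p"
  shows "card {d. d dvd p ^ a} = a + 1"
proof -
  have "{d. d dvd p ^ a} = (\<lambda>i. p ^ i) ` {..a}"
    using divides_primepow_nat[OF assms] by (auto intro: le_imp_power_dvd)
  moreover have "inj_on (\<lambda>i. p ^ i) {..a}"
    using prime_gt_1_nat[OF assms] by (auto simp: inj_on_def)
  ultimately show ?thesis by (simp add: card_image)
qed

text \<open>Submultiplicativity reduces the claim to prime powers, where \<open>a + 1\<close> is
  compared with \<open>p powr (a * \<eta>)\<close>. Once \<open>p powr \<eta>\<close> is at least 2,
  the comparison holds with constant 1. Each smaller prime costs a factor \<open>b\<close>, and
  there are at most \<open>P\<close> of them, so \<open>B = b ^ P\<close> works for all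
  \<open>n\<close> at once.\<close>

lemma divisor_bound:
  fixes \<eta> :: real
  assumes "\<eta> > 0"
  obtains B :: real where "B \<ge> 1" "\<And>n::nat. n > 0 \<Longrightarrow> real (card {d. d dvd n}) \<le> B * real n powr \<eta>"
proof -
  \<comment> \<open>Both \<open>b\<close> and \<open>b * (\<eta> * ln 2)\<close> are at least 1, so
    \<open>b * (1 + a * \<eta> * ln 2)\<close> dominates \<open>a + 1\<close>. The first-order bound
    for \<open>exp\<close> then handles the small primes.\<close>
  define b where "b = max 1 (1 / (\<eta> * ln 2))"
  define P where "P = nat \<lceil>2 powr (1 / \<eta>)\<rceil>"
  define w where "w p = (if p < P then b else 1)" for p :: nat
  have b1: "b \<ge> 1" by (simp add: b_def)
  have local_bound: "real (a + 1) \<le> w p * real (p ^ a) powr \<eta>" if p: "prime p" for p a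
  proof -
    have p2: "real p \<ge> 2" using prime_ge_2_nat[OF p] by simp
    have pow: "(real p ^ a) powr \<eta> = (real p powr \<eta>) ^ a"
      using p2 by (simp add: powr_realpow[symmetric] powr_powr mult.commute)
    show ?thesis
    proof (cases "p < P")
      case True
      have "1 + real a * (\<eta> * ln 2) \<le> exp (real a * (\<eta> * ln 2))"
        by (rule exp_ge_add_one_self)
      also have "\<dots> = (2 powr \<eta>) ^ a"
        by (simp add: powr_def exp_of_nat_mult)
      also have "\<dots> \<le> (real p powr \<eta>) ^ a"
        using p2 assms by (intro power_mono powr_mono2) auto
      finally have 1: "1 + real a * (\<eta> * ln 2) \<le> (real p powr \<eta>) ^ a" .
      have pos: "\<eta> * ln 2 > 0" using assms by simp
      have "1 / (\<eta> * ln 2) \<le> b" by (simp add: b_def)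
      then have "1 \<le> b * (\<eta> * ln 2)"
        using pos by (simp add: pos_divide_le_eq)
      then have "real a * 1 \<le> real a * (b * (\<eta> * ln 2))" by (intro mult_left_mono) auto
      then have "real (a + 1) \<le> b * (1 + real a * (\<eta> * ln 2))"
        using b1 by (simp add: algebra_simps)
      also have "\<dots> \<le> b * (real p powr \<eta>) ^ a"
        using 1 b1 by (intro mult_left_mono) auto
      finally show ?thesis using True by (simp add: pow w_def)
    next
      case False
      then have "2 powr (1 / \<eta>) \<le> real p" unfolding P_def by linarith
      then have "(2 powr (1 / \<eta>)) powr \<eta> \<le> real p powr \<eta>"
        using assms by (intro powr_mono2) auto
      then have "2 \<le> real p powr \<eta>" using assms by (simp add: powr_powr)
      then have "2 ^ a \<le> (real p powr \<eta>) ^ a" by (intro power_mono) auto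
      moreover have "real (a + 1) \<le> 2 ^ a"
        using of_nat_mono[OF Suc_leI[OF less_exp[of a]], where ?'a = real] by simp
      ultimately show ?thesis using False by (simp add: pow w_def)
    qed
  qed
  show ?thesis
  proof (rule that[of "b ^ P"])
    show "b ^ P \<ge> 1" using b1 by simp
  next
    fix n :: nat assume n: "n > 0"
    let ?S = "prime_factors n" and ?g = "\<lambda>p. p ^ multiplicity p n"
    have S: "finite ?S" by simp
    have g_pos: "?g p > 0" if "p \<in> ?S" for p
      using in_prime_factors_imp_prime[OF that] by (simp add: prime_gt_0_nat)
    have n_eq: "(\<Prod>p\<in>?S. ?g p) = n" using n prime_factorization_nat by metis
    have "card {d. d dvd n} \<le> (\<Prod>p\<in>?S. card {d. d dvd ?g p})"
      using card_divisors_prod_le[of ?S ?g, OF S g_pos] unfolding n_eq .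
    also have "\<dots> = (\<Prod>p\<in>?S. multiplicity p n + 1)"
      by (intro prod.cong refl card_divisors_prime_power) (rule in_prime_factors_imp_prime)
    finally have "real (card {d. d dvd n}) \<le> (\<Prod>p\<in>?S. real (multiplicity p n + 1))"
      by (metis of_nat_mono of_nat_prod)
    also have "\<dots> \<le> (\<Prod>p\<in>?S. w p * real (?g p) powr \<eta>)"
      by (intro prod_mono conjI local_bound) (auto dest: in_prime_factors_imp_prime)
    also have "\<dots> = (\<Prod>p\<in>?S. w p) * (\<Prod>p\<in>?S. real (?g p) powr \<eta>)"
      by (rule prod.distrib)
    also have "(\<Prod>p\<in>?S. real (?g p) powr \<eta>) = (\<Prod>p\<in>?S. real (?g p)) powr \<eta>"
      by (rule prod_powr_distrib[symmetric])
    also have "(\<Prod>p\<in>?S. real (?g p)) = real n" by (metis n_eq of_nat_prod)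
    also have "(\<Prod>p\<in>?S. w p) = (\<Prod>p\<in>?S \<inter> {..<P}. b)"
      unfolding w_def using prod.inter_restrict[OF S, of "\<lambda>_. b" "{..<P}"] by simp
    also have "\<dots> = b ^ card (?S \<inter> {..<P})" by simp
    also have "\<dots> \<le> b ^ P"
      using b1 card_mono[of "{..<P}" "?S \<inter> {..<P}"] by (intro power_increasing) auto
    finally show "real (card {d. d dvd n}) \<le> b ^ P * real n powr \<eta>"
      by (simp add: mult_right_mono)
  qed
qed

section \<open>Counting distinct s-fold products\<close>

lemma card_le_fibre_bound:
  fixes K :: real
  assumes "finite A" "\<And>y. y \<in> f ` A \<Longrightarrow> real (card {x \<in> A. f x = y}) \<le> K"
  shows "real (card A) \<le> K * real (card (f ` A))"
proof -
  have "real (card A) = (\<Sum>x\<in>A. 1)" by simp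
  also have "\<dots> = (\<Sum>y\<in>f ` A. \<Sum>x\<in>{x \<in> A. f x = y}. 1)"
    using assms(1) by (rule sum.image_gen)
  also have "\<dots> \<le> (\<Sum>y\<in>f ` A. K)"
    using assms(2) by (intro sum_mono) simp
  finally show ?thesis by (simp add: mult.commute)
qed

text \<open>Factors may repeat. They are indexed by \<open>{1..s}\<close> so that membership unfolds
  to the form in which the theorem asks for the factorisation.\<close>

definition product_set :: "nat \<Rightarrow> int set \<Rightarrow> int set" where
  "product_set s C = {\<Prod>j=1..s. c j |c. \<forall>j\<in>{1..s}. c j \<in> C}"

lemma product_set_0 [simp]: "product_set 0 C = {1}"
  by (auto simp: product_set_def)

lemma product_set_Suc: "product_set (Suc s) C = (\<lambda>(p, c). p * c) ` (product_set s C \<times> C)"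
proof (intro set_eqI iffI)
  fix x assume "x \<in> (\<lambda>(p, c). p * c) ` (product_set s C \<times> C)"
  then obtain c a where c: "\<forall>j\<in>{1..s}. c j \<in> C" "a \<in> C" "x = (\<Prod>j=1..s. c j) * a"
    by (auto simp: product_set_def)
  have "(\<Prod>j=1..s. (c(Suc s := a)) j) = (\<Prod>j=1..s. c j)"
    by (rule prod.cong) auto
  then have "(\<Prod>j=1..Suc s. (c(Suc s := a)) j) = x"
    by (simp add: c(3))
  moreover have "\<forall>j\<in>{1..Suc s}. (c(Suc s := a)) j \<in> C" using c by auto
  ultimately show "x \<in> product_set (Suc s) C"
    unfolding product_set_def by (intro CollectI exI[of _ "c(Suc s := a)"]) simp
next
  fix x assume "x \<in> product_set (Suc s) C"
  then obtain c where c: "\<forall>j\<in>{1..Suc s}. c j \<in> C" "x = (\<Prod>j=1..Suc s. c j)"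
    by (auto simp: product_set_def)
  then have "x = (\<Prod>j=1..s. c j) * c (Suc s)" by simp
  moreover have "(\<Prod>j=1..s. c j) \<in> product_set s C" using c by (auto simp: product_set_def)
  ultimately show "x \<in> (\<lambda>(p, c). p * c) ` (product_set s C \<times> C)"
    using c by (intro image_eqI[of _ _ "(\<Prod>j=1..s. c j, c (Suc s))"]) auto
qed

lemma finite_product_set: "finite C \<Longrightarrow> finite (product_set s C)"
  by (induction s) (auto simp: product_set_Suc)

lemma product_set_bounds:
  assumes "\<forall>c\<in>C. 1 \<le> c \<and> real_of_int c \<le> D" "p \<in> product_set s C"
  shows "1 \<le> p \<and> real_of_int p \<le> D ^ s"
  using assms(2)
proof (induction s arbitrary: p)
  case (Suc s)
  then obtain q c where q: "q \<in> product_set s C" "c \<in> C" "p = q * c"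
    by (auto simp: product_set_Suc)
  have "1 \<le> q" "real_of_int q \<le> D ^ s" "1 \<le> c" "real_of_int c \<le> D"
    using Suc.IH[OF q(1)] assms(1) q(2) by auto
  then show ?case
    using mult_mono[of 1 q 1 c] mult_mono[of "real_of_int q" "D ^ s" "real_of_int c" D]
    by (auto simp: q(3) mult.commute)
qed simp

lemma product_set_mult_power:
  assumes "p \<in> product_set s C" "b \<in> C"
  shows "p * b ^ m \<in> product_set (s + m) C"
proof (induction m)
  case (Suc m)
  then show ?case using assms(2)
    by (auto simp: product_set_Suc intro!: image_eqI[of _ _ "(p * b ^ m, b)"])
qed (use assms in simp)

text \<open>Each additional factor loses at most \<open>\<Delta>\<close>: in the fibre of
  multiplication over \<open>y\<close>, the last factor \<open>c\<close> is a divisor of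
  \<open>y\<close> and determines the pair. Every such \<open>y\<close> is at most
  \<open>D ^ r\<close>, so one divisor bound serves all \<open>s\<close> steps.\<close>

lemma card_product_set_ge:
  fixes \<Delta> :: real
  assumes fin: "finite C" and C: "\<forall>c\<in>C. 1 \<le> c \<and> real_of_int c \<le> D" and "D \<ge> 1"
    and \<Delta>: "\<And>m::nat. m > 0 \<Longrightarrow> real m \<le> D ^ r \<Longrightarrow> real (card {d. d dvd m}) \<le> \<Delta>"
    and "s \<le> r"
  shows "real (card C) ^ s \<le> \<Delta> ^ s * real (card (product_set s C))"
  using \<open>s \<le> r\<close>
proof (induction s)
  case (Suc s)
  let ?P = "product_set s C" and ?f = "\<lambda>(p, c). p * c :: int"
  have "real (card {d. d dvd (1::nat)}) \<le> \<Delta>" using \<open>D \<ge> 1\<close> by (intro \<Delta>) auto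
  then have \<Delta>0: "\<Delta> \<ge> 0" by linarith
  have fibre: "real (card {x \<in> ?P \<times> C. ?f x = y}) \<le> \<Delta>" if "y \<in> ?f ` (?P \<times> C)" for y
  proof -
    have "y \<in> product_set (Suc s) C" using that by (simp add: product_set_Suc)
    then have y: "1 \<le> y" "real_of_int y \<le> D ^ Suc s" using product_set_bounds[OF C] by blast+
    moreover have "D ^ Suc s \<le> D ^ r" using Suc.prems \<open>D \<ge> 1\<close> by (intro power_increasing) auto
    ultimately have "real (nat y) \<le> D ^ r" by simp
    have "card {x \<in> ?P \<times> C. ?f x = y} \<le> card {d. d dvd nat y}"
    proof (rule card_inj_on_le)
      show "inj_on (\<lambda>(p, c). nat c) {x \<in> ?P \<times> C. ?f x = y}"
      proof (rule inj_onI, goal_cases)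
        case (1 v w)
        obtain p c p' c' where vw: "v = (p, c)" "w = (p', c')" by (cases v, cases w)
        have "1 \<le> c" "1 \<le> c'" "p * c = p' * c'" "nat c = nat c'" using 1 C by (auto simp: vw)
        then have "c = c'" "c \<noteq> 0" "p * c = p' * c" by auto
        then show ?case by (simp add: vw)
      qed
      show "(\<lambda>(p, c). nat c) ` {x \<in> ?P \<times> C. ?f x = y} \<subseteq> {d. d dvd nat y}"
        using C y by (force simp: nat_dvd_iff)
      show "finite {d. d dvd nat y}" using y by (simp add: finite_divisors_nat)
    qed
    also have "real (card {d. d dvd nat y}) \<le> \<Delta>"
      using y \<open>real (nat y) \<le> D ^ r\<close> by (intro \<Delta>) auto
    finally show ?thesis by simp
  qed
  have "real (card C) ^ Suc s = real (card C) * real (card C) ^ s" by simp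
  also have "\<dots> \<le> real (card C) * (\<Delta> ^ s * real (card ?P))"
    using Suc by (intro mult_left_mono) auto
  also have "\<dots> = \<Delta> ^ s * real (card (?P \<times> C))" by (simp add: card_cartesian_product)
  also have "\<dots> \<le> \<Delta> ^ s * (\<Delta> * real (card (?f ` (?P \<times> C))))"
    using fin \<Delta>0 fibre by (intro mult_left_mono card_le_fibre_bound) (auto simp: finite_product_set)
  finally show ?case by (simp add: product_set_Suc mult_ac)
qed simp

section \<open>Short intervals and the choice of s\<close>

lemma pigeonhole_short_interval:
  fixes Q :: "int set" and H L K :: real
  assumes "finite Q" "H > 0" and Q: "\<And>x. x \<in> Q \<Longrightarrow> 0 \<le> x \<and> real_of_int x \<le> L"
    and large: "K * (L / H + 1) < real (card Q)" and "K \<ge> 0" "L \<ge> 0"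
  obtains S where "S \<subseteq> Q" "K < real (card S)"
    "\<And>x y. x \<in> S \<Longrightarrow> y \<in> S \<Longrightarrow> real_of_int (y - x) < H"
proof -
  \<comment> \<open>The cells are half-open of length \<open>H\<close>, so members of one cell
    differ by strictly less than \<open>H\<close>. At most \<open>L / H + 1\<close> cells meet
    \<open>[0, L]\<close>.\<close>
  define f where "f x = \<lfloor>real_of_int x / H\<rfloor>" for x :: int
  have "\<exists>y\<in>f ` Q. K < real (card {x \<in> Q. f x = y})"
  proof (rule ccontr)
    assume "\<not> ?thesis"
    then have "real (card Q) \<le> K * real (card (f ` Q))"
      using \<open>finite Q\<close> by (intro card_le_fibre_bound) (auto simp: not_less)
    also have "f ` Q \<subseteq> {0..\<lfloor>L / H\<rfloor>}"
      using Q \<open>H > 0\<close> by (auto simp: f_def intro!: floor_mono divide_right_mono)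
    then have "card (f ` Q) \<le> nat (\<lfloor>L / H\<rfloor> + 1)"
      using card_mono[of "{0..\<lfloor>L / H\<rfloor>}" "f ` Q"] by simp
    then have "real (card (f ` Q)) \<le> L / H + 1"
      using \<open>L \<ge> 0\<close> \<open>H > 0\<close> by (auto simp: of_nat_le_iff intro: order_trans[OF of_nat_mono])
    then have "K * real (card (f ` Q)) \<le> K * (L / H + 1)" using \<open>K \<ge> 0\<close> by (rule mult_left_mono)
    finally show False using large by simp
  qed
  then obtain y where y: "K < real (card {x \<in> Q. f x = y})" by blast
  show ?thesis
  proof (rule that[of "{x \<in> Q. f x = y}"])
    fix a b assume "a \<in> {x \<in> Q. f x = y}" "b \<in> {x \<in> Q. f x = y}"
    then have "\<lfloor>real_of_int a / H\<rfloor> = \<lfloor>real_of_int b / H\<rfloor>" by (simp add: f_def)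
    then have "real_of_int b / H - real_of_int a / H < 1" by linarith
    then show "real_of_int (b - a) < H" using \<open>H > 0\<close> by (simp add: field_simps)
  qed (use y in auto)
qed

lemma finite_set_increasing_enumeration:
  fixes S :: "'a::linorder set"
  assumes "finite S"
  obtains x :: "nat \<Rightarrow> 'a" where "strict_mono_on {1..card S} x" "x ` {1..card S} = S"
proof -
  \<comment> \<open>The sequence starts at index 1, the list at index 0.\<close>
  define x where "x i = sorted_list_of_set S ! (i - 1)" for i
  have len: "length (sorted_list_of_set S) = card S" by simp
  show ?thesis
  proof (rule that[of x])
    show "strict_mono_on {1..card S} x"
      unfolding x_def using strict_sorted_list_of_set[of S]
      by (intro strict_mono_onI) (auto simp: sorted_wrt_iff_nth_less len)
    have "x ` {1..card S} = (!) (sorted_list_of_set S) ` {..<card S}"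
      unfolding x_def by (force simp: image_iff Bex_def intro: exI[of _ "Suc _"])
    also have "\<dots> = S" using assms len by (metis lessThan_atLeast0 list.set_map map_nth set_sorted_list_of_set set_upt)
    finally show "x ` {1..card S} = S" .
  qed
qed

text \<open>All inequalities compare exponents of \<open>D\<close>. The first on the second line of
  the conclusion makes the multiplier \<open>b ^ (r - s)\<close> at least the smallest admissible
  gap. The last two make the s-fold products outnumber the intervals by a factor of order
  \<open>D powr (1 / 4)\<close>; the final one covers \<open>u < 3\<close>, where the number of
  intervals is merely bounded.\<close>

lemma exponent_choice:
  fixes r \<alpha> :: real
  assumes r: "r \<ge> 3" and \<alpha>: "0 < \<alpha>" "\<alpha> < 1 / ((r + 1) * sqrt (2 * r))"
  obtains s :: nat where "s \<ge> 1" "real s \<le> r"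
    "r - sqrt (2 * r) + 1 \<le> (1 - \<alpha>) * (r - real s)"
    "sqrt (2 * r) - 3 + 1 / 4 \<le> real s * (1 - \<alpha>)" "1 / 4 \<le> real s * (1 - \<alpha>)"
proof -
  define u where "u = sqrt (2 * r)"
  have u2: "u\<^sup>2 = 2 * r" using r by (simp add: u_def)
  \<comment> \<open>A rational lower bound for \<open>sqrt 6\<close>, sharp enough to give both
    \<open>v \<ge> 1\<close> and the numerical margin in the counting inequality.\<close>
  have u: "u \<ge> 61 / 25"
    unfolding u_def using r by (intro real_le_rsqrt) (simp add: power2_eq_square)
  have "u \<le> r"
    unfolding u_def using r by (intro real_le_lsqrt) (auto simp: power2_eq_square)
  have "\<alpha> * ((r + 1) * u) < 1"
    using \<alpha> r u by (simp add: pos_less_divide_eq flip: u_def)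
  then have ru: "\<alpha> * r * u + \<alpha> * u < 1" by (simp add: algebra_simps)
  have au0: "0 < \<alpha> * u" using \<alpha> u by simp
  have "\<alpha> * r * (61 / 25) \<le> \<alpha> * r * u" using \<alpha> r u by (intro mult_left_mono) auto
  then have ar: "\<alpha> * r < 25 / 61" using ru au0 by linarith
  have "\<alpha> * u * 3 \<le> \<alpha> * u * r" using au0 r by (intro mult_left_mono) auto
  then have au: "\<alpha> * u < 1 / 4" using ru by (simp add: mult_ac)
  \<comment> \<open>After the nonnegative term \<open>\<alpha> * s\<close> is dropped, the
    separation inequality reads \<open>s \<le> v\<close>.\<close>
  define v where "v = u - 1 - \<alpha> * r"
  define s where "s = nat \<lfloor>v\<rfloor>"
  have "\<alpha> * r > 0" using \<alpha> r by simp
  then have v: "v < u - 1" by (simp add: v_def)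
  have v1: "v \<ge> 1" using ar u by (simp add: v_def)
  have s: "real s \<le> v" "v < real s + 1" "s \<ge> 1" using v1 by (simp_all add: s_def le_nat_iff)
  have "\<alpha> * real s \<le> \<alpha> * u" using \<alpha> s v by (intro mult_left_mono) auto
  then have as: "\<alpha> * real s < 1 / 4" using au by linarith
  have as0: "\<alpha> * real s \<ge> 0" using \<alpha> by simp
  show ?thesis
  proof (rule that[of s, folded u_def])
    show "s \<ge> 1" by (rule s)
    show "real s \<le> r" using s v \<open>u \<le> r\<close> by linarith
    have "(1 - \<alpha>) * (r - real s) = r - real s - \<alpha> * r + \<alpha> * real s" by (simp add: algebra_simps)
    then show "r - u + 1 \<le> (1 - \<alpha>) * (r - real s)" using s as0 unfolding v_def by linarith
    have eq: "real s * (1 - \<alpha>) = real s - \<alpha> * real s" by (simp add: algebra_simps)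
    \<comment> \<open>Rounding \<open>v\<close> down costs less than 1, and
      \<open>25 / 61 + 1 / 4 < 3 / 4\<close> bounds the losses from \<open>\<alpha>\<close>, which
      leaves the surplus 1/4.\<close>
    show "u - 3 + 1 / 4 \<le> real s * (1 - \<alpha>)" using s as ar unfolding eq v_def by linarith
    show "1 / 4 \<le> real s * (1 - \<alpha>)" using s as unfolding eq by linarith
  qed
qed

section \<open>Many products with admissible gaps in one short interval\<close>

theorem corollary1p8:
  fixes r :: nat and \<alpha> :: real
  assumes "r \<ge> 3"
    and "\<exists>k::int. real r = real_of_int k * (real_of_int k + 1) / 2"
    and "0 < \<alpha>"
    and "\<alpha> < 1 / ((real r + 1) * sqrt (2 * real r))"
  shows "\<exists>(N\<^sub>0::real) (\<kappa>::real). \<kappa> > 0 \<and>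
    (\<forall>(N::int) (C::int set).
       real_of_int N > N\<^sub>0 \<and>
       (\<forall>c\<in>C. 1 \<le> c \<and> real_of_int c \<le> real_of_int N powr (1 / real r)) \<and>
       real (card C) > real_of_int N powr ((1 - \<alpha>) / real r)
       \<longrightarrow>
       (\<exists>(M::int) (n::nat) (x::nat \<Rightarrow> int) (\<epsilon>::nat \<Rightarrow> real).
          0 < M \<and> M < N \<and>
          real n > \<kappa> * real_of_int M powr
            (1 / (sqrt 2 * real r powr (5/2) * (real r + 1)) - \<alpha> / real r ^ 2) \<and>
          strict_mono_on {1..n} x \<and>
          (\<forall>i\<in>{1..n}. x i \<in> {1..2 * M} \<and>
             (\<exists>c::nat \<Rightarrow> int. (\<forall>j\<in>{1..r}. c j \<in> C) \<and> x i = (\<Prod>j=1..r. c j))) \<and>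
          (\<forall>i\<in>{1..<n}.
             real_of_int (x (i + 1) - x i) =
               \<kappa> * real_of_int M powr (1 - sqrt (2 / real r) + \<epsilon> i) \<and>
             1 / real r \<le> \<epsilon> i \<and> \<epsilon> i \<le> 3 / real r)))"
proof -
  define u where "u = sqrt (2 * real r)"
  have r: "real r \<ge> 3" using \<open>r \<ge> 3\<close> by simp
  have u_le: "u \<le> real r"
    unfolding u_def using r by (intro real_le_lsqrt) (auto simp: power2_eq_square)
  have u_ge: "u \<ge> 2"
    unfolding u_def using r by (intro real_le_rsqrt) (simp add: power2_eq_square)
  have sqrt_eq: "sqrt (2 / real r) = u / real r"
    using r by (simp add: u_def real_sqrt_divide real_sqrt_mult field_simps)
  obtain s :: nat where s: "s \<ge> 1" "s \<le> r"
    and s_sep: "real r - u + 1 \<le> (1 - \<alpha>) * (real r - real s)"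
    and s_count: "u - 3 + 1 / 4 \<le> real s * (1 - \<alpha>)" "1 / 4 \<le> real s * (1 - \<alpha>)"
    using exponent_choice[OF r assms(3,4)] unfolding u_def of_nat_le_iff by blast
  define \<sigma> where "\<sigma> = real s * (1 - \<alpha>)"
  \<comment> \<open>Chosen so that \<open>s\<close> uses of the divisor bound at size
    \<open>N = D ^ r\<close> cost \<open>D powr (r * s * \<eta>) = D powr (1 / 12)\<close>.\<close>
  define \<eta> where "\<eta> = 1 / (12 * real r * real s)"
  have "\<eta> > 0" using r s by (simp add: \<eta>_def)
  then obtain B :: real where B: "B \<ge> 1"
    and divisors: "\<And>n::nat. n > 0 \<Longrightarrow> real (card {d. d dvd n}) \<le> B * real n powr \<eta>"
    using divisor_bound by blast
  define e where "e = 1 / (sqrt 2 * real r powr (5/2) * (real r + 1)) - \<alpha> / real r ^ 2"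
  \<comment> \<open>\<open>h\<close> and \<open>t\<close> are the values of the exponent
    \<open>1 - sqrt (2 / r) + \<epsilon>\<close> at the extremes \<open>\<epsilon> = 1 / r\<close>
    and \<open>\<epsilon> = 3 / r\<close>.\<close>
  define t where "t = (real r - u + 3) / real r"
  define h where "h = (real r - u + 1) / real r"
  have e_le: "e \<le> 1 / (12 * real r)"
  proof -
    have "3 * real r * 4 \<le> sqrt 2 * real r powr (5/2) * (real r + 1)"
    proof -
      have "3 * real r \<le> real r powr 2" using r by (simp add: power2_eq_square)
      also have "\<dots> \<le> real r powr (5/2)" using r by (intro powr_mono) auto
      also have "\<dots> \<le> sqrt 2 * real r powr (5/2)"
        using mult_right_mono[of 1 "sqrt 2" "real r powr (5/2)"] by simp
      finally have "3 * real r \<le> sqrt 2 * real r powr (5/2)" .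
      from mult_mono[OF this, of 4 "real r + 1"] show ?thesis using r by simp
    qed
    then have "1 / (sqrt 2 * real r powr (5/2) * (real r + 1)) \<le> 1 / (12 * real r)"
      using r by (intro divide_left_mono) auto
    moreover have "0 \<le> \<alpha> / real r ^ 2" using assms(3) by simp
    ultimately show ?thesis unfolding e_def by linarith
  qed
  have t: "0 \<le> t" "t \<le> 2" using r u_le u_ge by (auto simp: t_def field_simps)
  have h: "0 \<le> h" using u_le by (simp add: h_def)
  show ?thesis
  \<comment> \<open>Beyond this threshold \<open>D powr (1 / 12)\<close> exceeds
    \<open>5 * B ^ s\<close>, the product of all constants lost below; the 2 forces
    \<open>M \<ge> 2\<close>, so that logarithms to base \<open>M\<close> make sense.\<close>
  proof (rule exI[of _ "max 2 ((5 * B ^ s) powr (12 * real r))"], rule exI[of _ 1],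
      intro conjI allI impI, goal_cases)
    case 1
    show ?case by simp
  next
    case (2 N C)
    \<comment> \<open>Then \<open>N \<le> 2 * M\<close>, so products up to \<open>N\<close> lie in
      the required range, and powers of \<open>M\<close> and \<open>N\<close> differ by bounded
      factors.\<close>
    define M where "M = N - 1"
    define D where "D = real_of_int N powr (1 / real r)"
    from 2 have N: "N \<ge> 3" "real_of_int N > (5 * B ^ s) powr (12 * real r)"
      and C: "\<forall>c\<in>C. 1 \<le> c \<and> real_of_int c \<le> D"
      by (auto simp: D_def)
    have M: "M \<ge> 2" "real_of_int M \<ge> real_of_int N / 2" "M < N" using N by (auto simp: M_def)
    have D1: "D \<ge> 1" unfolding D_def using N r by (intro ge_one_powr_ge_zero) auto
    have N_powr: "real_of_int N powr a = D powr (real r * a)" for a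
      using r by (simp add: D_def powr_powr)
    have D_powr_nat: "(D powr a) ^ m = D powr (real m * a)" for a and m :: nat
      using D1 by (simp add: powr_realpow[symmetric] powr_powr mult.commute)
    have D_r: "D ^ r = real_of_int N"
      using D1 N N_powr[of 1] by (simp add: powr_realpow[symmetric])
    have cardC: "D powr (1 - \<alpha>) < real (card C)"
      using 2 r by (simp add: N_powr)
    \<comment> \<open>Since \<open>card\<close> is 0 on infinite sets, positivity gives finiteness
      as well as nonemptiness.\<close>
    then have "card C > 0" by (metis of_nat_0_less_iff order_le_less_trans powr_ge_zero)
    then have C_fin: "finite C" "C \<noteq> {}" by (auto intro: card_ge_0_finite)
    have D_big: "5 * B ^ s < D powr (1 / 12)"
    proof -
      have "((5 * B ^ s) powr (12 * real r)) powr (1 / (12 * real r)) < real_of_int N powr (1 / (12 * real r))"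
        using N r by (intro powr_less_mono2) auto
      then show ?thesis using r B by (simp add: powr_powr N_powr)
    qed

    let ?P = "product_set s C"
    have P_card: "D powr \<sigma> \<le> B ^ s * D powr (1 / 12) * real (card ?P)"
    proof -
      have "D powr \<sigma> = (D powr (1 - \<alpha>)) ^ s" by (simp add: D_powr_nat \<sigma>_def)
      also have "\<dots> \<le> real (card C) ^ s" using cardC by (intro power_mono) auto
      also have "\<dots> \<le> (B * real_of_int N powr \<eta>) ^ s * real (card ?P)"
      proof (rule card_product_set_ge[OF C_fin(1) C D1 _ \<open>s \<le> r\<close>])
        fix m :: nat assume m: "m > 0" "real m \<le> D ^ r"
        have "B * real m powr \<eta> \<le> B * real_of_int N powr \<eta>"
          using m B \<open>\<eta> > 0\<close> by (intro mult_left_mono powr_mono2) (auto simp: D_r)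
        then show "real (card {d. d dvd m}) \<le> B * real_of_int N powr \<eta>"
          using divisors[OF m(1)] by linarith
      qed
      also have "(B * real_of_int N powr \<eta>) ^ s = B ^ s * D powr (1 / 12)"
        using r s by (simp add: power_mult_distrib N_powr D_powr_nat \<eta>_def)
      finally show ?thesis .
    qed

    define b where "b = Max C"
    define q where "q = b ^ (r - s)"
    have bC: "b \<in> C" using C_fin by (simp add: b_def)
    have b: "1 \<le> b" "real_of_int b \<le> D" using C bC by auto
    \<comment> \<open>A set of positive integers has a maximum at least as large as its
      cardinality.\<close>
    have "C \<subseteq> {1..b}" using C C_fin by (auto simp: b_def)
    then have "card C \<le> nat b" using card_mono[of "{1..b}" C] by simp
    then have b_ge: "D powr (1 - \<alpha>) \<le> real_of_int b" using cardC b by linarith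
    have q1: "q \<ge> 1" using b by (simp add: q_def)
    have q_ge: "real_of_int M powr h \<le> real_of_int q"
    proof -
      have "real_of_int M powr h \<le> real_of_int N powr h" using M h by (intro powr_mono2) auto
      also have "\<dots> = D powr (real r - u + 1)" using r by (simp add: N_powr h_def)
      also have "\<dots> \<le> D powr ((1 - \<alpha>) * (real r - real s))" using s_sep D1 by (intro powr_mono) auto
      also have "\<dots> = (D powr (1 - \<alpha>)) ^ (r - s)" using s by (simp add: D_powr_nat of_nat_diff mult.commute)
      also have "\<dots> \<le> real_of_int b ^ (r - s)" using b_ge by (intro power_mono) auto
      finally show ?thesis by (simp add: q_def)
    qed

    \<comment> \<open>All members are multiples of \<open>q\<close>, so distinct ones differ by at
      least \<open>q\<close>, hence by at least \<open>M powr h\<close>.\<close>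
    define Q where "Q = (\<lambda>p. p * q) ` ?P"
    have Q_prod: "x \<in> product_set r C" if "x \<in> Q" for x
      using that product_set_mult_power[OF _ bC, of _ s "r - s"] s by (auto simp: Q_def q_def)
    have Q_bounds: "1 \<le> x \<and> real_of_int x \<le> real_of_int N" if "x \<in> Q" for x
      using product_set_bounds[OF C Q_prod[OF that]] D_r by simp
    have "inj_on (\<lambda>p. p * q) ?P" using q1 by (auto simp: inj_on_def)
    then have Q_card: "card Q = card ?P" by (simp add: Q_def card_image)
    have Q_fin: "finite Q" using C_fin by (simp add: Q_def finite_product_set)

    define H where "H = real_of_int M powr t"
    have H0: "H > 0" using M by (simp add: H_def)
    \<comment> \<open>This bounds the number of intervals. Passing from \<open>M\<close> to
      \<open>N\<close> costs \<open>2 powr t\<close>, at most 4.\<close>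
    have H_ge: "real_of_int N / H \<le> 4 * D powr (u - 3)"
    proof -
      have "real_of_int N powr t / 4 \<le> real_of_int N powr t / 2 powr t"
        using t powr_mono[of t 2 2] by (intro divide_left_mono) auto
      also have "\<dots> = (real_of_int N / 2) powr t" using N by (simp add: powr_divide)
      also have "\<dots> \<le> H" unfolding H_def using M N t by (intro powr_mono2) auto
      finally have "real_of_int N / H \<le> real_of_int N / (real_of_int N powr t / 4)"
        using N H0 by (intro divide_left_mono) auto
      also have "\<dots> = 4 * real_of_int N powr (1 - t)" using N by (simp add: powr_diff)
      also have "real r * (1 - t) = u - 3" using r by (simp add: t_def field_simps)
      then have "real_of_int N powr (1 - t) = D powr (u - 3)" by (simp add: N_powr)
      finally show ?thesis by simp
    qed
    \<comment> \<open>The surplus 1/4 splits into three twelfths: one pays for the divisor bound,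
      one for the constant \<open>5 * B ^ s\<close>, and one is the number of products wanted in a
      single interval. The 5 is the 4 of \<open>H_ge\<close> plus 1 for the extra interval.\<close>
    have large: "D powr (1 / 12) * (real_of_int N / H + 1) < real (card Q)"
    proof -
      have "D powr (u - 3) \<le> D powr (\<sigma> - 1 / 4)" "D powr 0 \<le> D powr (\<sigma> - 1 / 4)"
        using s_count D1 unfolding \<sigma>_def by (intro powr_mono; simp)+
      then have "real_of_int N / H + 1 \<le> 5 * D powr (\<sigma> - 1 / 4)" using H_ge D1 by simp
      then have "D powr (1 / 12) * (real_of_int N / H + 1) \<le> D powr (1 / 12) * (5 * D powr (\<sigma> - 1 / 4))"
        by (intro mult_left_mono) auto
      also have "\<dots> = 5 * D powr (\<sigma> - 1 / 6)" by (simp flip: powr_add)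
      also have "\<dots> < real (card ?P)"
      proof -
        have "(B ^ s * D powr (1 / 12)) * (5 * D powr (\<sigma> - 1 / 6)) = 5 * B ^ s * D powr (\<sigma> - 1 / 12)"
          by (simp flip: powr_add)
        also have "\<dots> < D powr (1 / 12) * D powr (\<sigma> - 1 / 12)"
          using D_big D1 by (intro mult_strict_right_mono) auto
        also have "\<dots> = D powr \<sigma>" by (simp flip: powr_add)
        also have "\<dots> \<le> (B ^ s * D powr (1 / 12)) * real (card ?P)" using P_card .
        finally show ?thesis using B D1 by (subst (asm) mult_less_cancel_left_pos) auto
      qed
      finally show ?thesis by (simp add: Q_card)
    qed
    obtain S where S: "S \<subseteq> Q" "D powr (1 / 12) < real (card S)"
      and S_close: "\<And>x y. x \<in> S \<Longrightarrow> y \<in> S \<Longrightarrow> real_of_int (y - x) < H"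
    proof (rule pigeonhole_short_interval[OF Q_fin H0 _ large])
      show "0 \<le> x \<and> real_of_int x \<le> real_of_int N" if "x \<in> Q" for x
        using Q_bounds[OF that] by auto
    qed (use N in auto)
    have "finite S" using S(1) Q_fin by (rule finite_subset)
    then obtain x where x: "strict_mono_on {1..card S} x" "x ` {1..card S} = S"
      using finite_set_increasing_enumeration by blast
    have xS: "x i \<in> S" if "i \<in> {1..card S}" for i using x(2) that by blast
    \<comment> \<open>Solving the gap equation for the exponent makes it hold exactly; what remains
      is to locate the logarithm of the gap between \<open>h\<close> and \<open>t\<close>.\<close>
    define \<epsilon> where "\<epsilon> i = log (real_of_int M) (real_of_int (x (i + 1) - x i)) - (1 - u / real r)" for i

    have "real_of_int M powr e \<le> real_of_int M powr (1 / (12 * real r))"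
      using M e_le by (intro powr_mono) auto
    also have "\<dots> \<le> real_of_int N powr (1 / (12 * real r))" using M r by (intro powr_mono2) auto
    also have "\<dots> = D powr (1 / 12)" using r by (simp add: N_powr)
    finally have n: "1 * real_of_int M powr e < real (card S)" using S(2) by simp

    have members: "x i \<in> {1..2 * M} \<and> (\<exists>c. (\<forall>j\<in>{1..r}. c j \<in> C) \<and> x i = (\<Prod>j=1..r. c j))"
      if i: "i \<in> {1..card S}" for i
    proof -
      have "x i \<in> Q" using xS[OF i] S(1) by blast
      from Q_prod[OF this] Q_bounds[OF this] N show ?thesis
        by (auto simp: product_set_def M_def)
    qed

    have gaps: "real_of_int (x (i + 1) - x i) =
               1 * real_of_int M powr (1 - sqrt (2 / real r) + \<epsilon> i) \<and>
             1 / real r \<le> \<epsilon> i \<and> \<epsilon> i \<le> 3 / real r" if i: "i \<in> {1..<card S}" for i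
    proof -
      let ?d = "x (i + 1) - x i"
      have mem: "x i \<in> S" "x (i + 1) \<in> S" using i by (auto intro: xS)
      have "x i < x (i + 1)" using i by (intro strict_mono_onD[OF x(1)]) auto
      moreover obtain p p' where p: "x i = p * q" "x (i + 1) = p' * q"
        using mem S(1) unfolding Q_def by blast
      ultimately have "p < p'" using q1 by simp
      then have "1 * q \<le> (p' - p) * q" using q1 by (intro mult_right_mono) auto
      then have "q \<le> ?d" unfolding p by (simp add: algebra_simps)
      then have d: "real_of_int M powr h \<le> real_of_int ?d" "real_of_int ?d > 0"
        using q_ge q1 by linarith+
      have d': "real_of_int ?d \<le> real_of_int M powr t"
        using S_close[OF mem] by (simp add: H_def)
      have "h \<le> log (real_of_int M) (real_of_int ?d)" "log (real_of_int M) (real_of_int ?d) \<le> t"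
        using d d' M by (simp_all add: le_log_iff log_le_iff)
      moreover have "h = 1 - u / real r + 1 / real r" "t = 1 - u / real r + 3 / real r"
        using r by (simp_all add: h_def t_def field_simps)
      ultimately have "1 / real r \<le> \<epsilon> i" "\<epsilon> i \<le> 3 / real r" unfolding \<epsilon>_def by linarith+
      moreover have "real_of_int M powr (1 - u / real r + \<epsilon> i) = real_of_int ?d"
        using d M by (simp add: \<epsilon>_def)
      ultimately show ?thesis by (simp add: sqrt_eq)
    qed

    show ?case
      using M n x(1) members gaps unfolding e_def
      by (intro exI[of _ M] exI[of _ "card S"] exI[of _ x] exI[of _ \<epsilon>]) auto
  qed
qed

end
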